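(* Let $\Omega\subset\mathbb R^n$ be an open set, let $v\in C^{1,\alpha}(\Omega,\mathbb R^m)$ with $v^\sharp e\in C^2$, and let $\varphi\in C_c^\infty(\mathbb R^n)$ be a standard symmetric convolution kernel. Then, for every compact set $K\subset\Omega$, $$\|(v*\varphi_\ell)^\sharp e-v^\sharp e\|_{C^1(K)}=O(\ell^{2\alpha-1})\qquad\text{as }\ell\downarrow0.$$
   Context: For a $C^1$ map $w$ into $\mathbb R^m$, $(w^\sharp e)_{ij}=\partial_i w\cdot\partial_j w$ denotes the pullback of the Euclidean metric. A standard symmetric convolution kernel is a function $\varphi\in C^\infty_c(\mathbb R^n)$ with $\varphi(-x)=\varphi(x)$ and $\int\varphi=1$, and $\varphi_\ell(x)=\ell^{-n}\varphi(x/\ell)$. Here $\alpha\in\,]0,1]$ is the Hölder exponent, and $v*\varphi_\ell$ is considered in a neighbourhood of $K$ for $\ell$ small enough that it is defined there. *)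

theory Defs
  imports "HOL-Analysis.Analysis" "HOL-Library.Landau_Symbols"
begin

(* k times continuously differentiable, for an open set S in finite dimension: continuity of all
   iterated directional derivatives up to order k, with Frechet differentiability at every order
   below k. *)
fun Ck_on :: "nat \<Rightarrow> ('a::euclidean_space \<Rightarrow> 'b::real_normed_vector) \<Rightarrow> 'a set \<Rightarrow> bool" where
  "Ck_on 0 f S \<longleftrightarrow> continuous_on S f"
| "Ck_on (Suc k) f S \<longleftrightarrow>
     (\<forall>x\<in>S. f differentiable (at x)) \<and> (\<forall>h. Ck_on k (\<lambda>x. frechet_derivative f (at x) h) S)"

(* The class C^{1,alpha} of an open set S, with the Hoelder condition on Df required uniformly on
   each compact subset of S; a globally Hoelder derivative is a special case. *)
definition C1_holder_on ::
    "real \<Rightarrow> ('a::euclidean_space \<Rightarrow> 'b::real_normed_vector) \<Rightarrow> 'a set \<Rightarrow> bool" where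
  "C1_holder_on \<alpha> f S \<longleftrightarrow> Ck_on 1 f S \<and>
     (\<forall>K. compact K \<and> K \<subseteq> S \<longrightarrow>
        (\<exists>C. \<forall>x\<in>K. \<forall>y\<in>K.
           onorm (\<lambda>h. frechet_derivative f (at x) h - frechet_derivative f (at y) h)
             \<le> C * dist x y powr \<alpha>))"

(* The zero is inserted only to make the supremum over the empty set equal to 0. The definition is
   meaningful when f is C^1 in a neighbourhood of K. *)
definition C1_norm ::
    "'a::euclidean_space set \<Rightarrow> ('a \<Rightarrow> 'b::real_normed_vector) \<Rightarrow> real" where
  "C1_norm K f =
     Sup (insert 0 ((\<lambda>x. norm (f x)) ` K)) +
     Sup (insert 0 ((\<lambda>x. onorm (frechet_derivative f (at x))) ` K))"

definition pullback_metric :: "(real ^ 'n \<Rightarrow> real ^ 'm) \<Rightarrow> real ^ 'n \<Rightarrow> real ^ 'n ^ 'n" where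
  "pullback_metric w x =
     (\<chi> i j. frechet_derivative w (at x) (axis i 1) \<bullet> frechet_derivative w (at x) (axis j 1))"

abbreviation tsupport :: "('a::topological_space \<Rightarrow> real) \<Rightarrow> 'a set" where
  "tsupport f \<equiv> closure (support_on UNIV f)"

definition standard_symmetric_kernel :: "(real ^ 'n \<Rightarrow> real) \<Rightarrow> bool" where
  "standard_symmetric_kernel \<phi> \<longleftrightarrow>
     (\<forall>k. Ck_on k \<phi> UNIV) \<and> compact (tsupport \<phi>) \<and>
     (\<forall>x. \<phi> (- x) = \<phi> x) \<and> (LINT x|lborel. \<phi> x) = 1"

definition rescaled_kernel :: "(real ^ 'n \<Rightarrow> real) \<Rightarrow> real \<Rightarrow> real ^ 'n \<Rightarrow> real" where
  "rescaled_kernel \<phi> l x = \<phi> (x /\<^sub>R l) / l ^ CARD('n)"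

definition convolve :: "(real ^ 'n \<Rightarrow> real ^ 'm) \<Rightarrow> (real ^ 'n \<Rightarrow> real) \<Rightarrow> real ^ 'n \<Rightarrow> real ^ 'm" where
  "convolve v \<psi> x = (LINT y|lborel. \<psi> y *\<^sub>R v (x - y))"

(* For v given on the open set \<Omega> only: at the points of U the integrand of convolve v \<psi> involves
   no value of v outside \<Omega>. *)
definition convolution_defined_on ::
    "(real ^ 'n) set \<Rightarrow> (real ^ 'n \<Rightarrow> real) \<Rightarrow> (real ^ 'n) set \<Rightarrow> bool" where
  "convolution_defined_on \<Omega> \<psi> U \<longleftrightarrow> (\<forall>x\<in>U. \<forall>y\<in>tsupport \<psi>. x - y \<in> \<Omega>)"

end

theory Submission
  imports Defs
begin

text \<open>
  Write \<open>f\<^sub>l\<close> for the convolution of \<open>f\<close> with the rescaled kernel, \<open>F i\<close> for the partial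
  derivatives of \<open>v\<close>, and \<open>g i j = F i \<bullet> F j\<close> for the entries of the metric. Since convolution
  commutes with differentiation, the error splits entrywise as
  \<open>(F i)\<^sub>l \<bullet> (F j)\<^sub>l - g i j = ((F i)\<^sub>l \<bullet> (F j)\<^sub>l - (F i \<bullet> F j)\<^sub>l) + ((g i j)\<^sub>l - g i j)\<close>.

  The second part sees the regularity of the metric only: \<open>g\<close> and \<open>Dg\<close> are Lipschitz near \<open>K\<close>, so
  averaging at scale \<open>l\<close> moves both by \<open>O(l)\<close> (\<open>mollification_error_C1_bound\<close>), and
  \<open>l \<le> l powr (2 * \<alpha> - 1)\<close> for \<open>l \<le> 1\<close>.

  The first part is the commutator of averaging with the product. It does not change under
  subtraction of constants from the factors, so near \<open>x\<close> each factor may be replaced by its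
  deviation from its value at \<open>x\<close>, which is \<open>O(l powr \<alpha>)\<close>. The commutator is therefore
  \<open>O(l powr (2 * \<alpha>))\<close>. In its derivative, which exists although \<open>F i\<close> is merely Hoelder continuous
  because it can be put on the kernel (\<open>mollify_has_derivative\<close>), the differentiated kernel has mean
  zero and size \<open>1 / l\<close>. The same subtraction of constants then gives \<open>O(l powr (2 * \<alpha> - 1))\<close>
  (\<open>commutator_C1_bound\<close>, from the identity \<open>average_inner_expansion\<close>).
\<close>

section \<open>Continuously differentiable maps\<close>

lemma Ck_on_1I:
  assumes "\<And>x. x \<in> S \<Longrightarrow> (f has_derivative D x) (at x)"
    and "\<And>h. continuous_on S (\<lambda>x. D x h)"
  shows "Ck_on 1 f S"
proof -
  have "frechet_derivative f (at x) = D x" if "x \<in> S" for x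
    using frechet_derivative_at[OF assms(1)[OF that]] by simp
  then have "continuous_on S (\<lambda>x. frechet_derivative f (at x) h)" for h
    using assms(2)[of h] by (simp cong: continuous_on_cong)
  then show ?thesis
    using assms(1) by (auto simp: differentiable_def)
qed

lemma Ck_on_1D:
  assumes "Ck_on 1 f S"
  shows "x \<in> S \<Longrightarrow> (f has_derivative frechet_derivative f (at x)) (at x)"
    and "continuous_on S (\<lambda>x. frechet_derivative f (at x) h)"
    and "continuous_on S f"
proof -
  have diff: "f differentiable (at x)" if "x \<in> S" for x
    using assms that by simp
  show "x \<in> S \<Longrightarrow> (f has_derivative frechet_derivative f (at x)) (at x)"
    using diff frechet_derivative_works by blast
  show "continuous_on S (\<lambda>x. frechet_derivative f (at x) h)"
    using assms by simp
  show "continuous_on S f"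
    using diff by (simp add: continuous_at_imp_continuous_on differentiable_imp_continuous_within)
qed

lemma Ck_on_cong:
  assumes "open S" "\<And>x. x \<in> S \<Longrightarrow> f x = g x"
  shows "Ck_on k f S \<longleftrightarrow> Ck_on k g S"
  using assms(2)
proof (induction k arbitrary: f g)
  case 0
  then show ?case by (simp cong: continuous_on_cong)
next
  case (Suc k)
  have der: "(f has_derivative D) (at x) \<longleftrightarrow> (g has_derivative D) (at x)" if "x \<in> S" for x D
    using has_derivative_transform_within_open[OF _ assms(1) that, of f D UNIV g]
      has_derivative_transform_within_open[OF _ assms(1) that, of g D UNIV f] Suc.prems by auto
  then have "frechet_derivative f (at x) = frechet_derivative g (at x)" if "x \<in> S" for x
    using that unfolding frechet_derivative_def by simp
  then have "Ck_on k (\<lambda>x. frechet_derivative f (at x) h) S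
      \<longleftrightarrow> Ck_on k (\<lambda>x. frechet_derivative g (at x) h) S" for h
    by (intro Suc.IH) simp
  then show ?case
    using der by (simp add: differentiable_def)
qed

lemma Ck_on_bounded_linear:
  assumes "bounded_linear L" "open S" "Ck_on k f S"
  shows "Ck_on k (\<lambda>x. L (f x)) S"
  using assms(3)
proof (induction k arbitrary: f)
  case 0
  then show ?case
    using bounded_linear.continuous_on[OF assms(1)] by simp
next
  case (Suc k)
  have der: "((\<lambda>x. L (f x)) has_derivative (\<lambda>h. L (frechet_derivative f (at x) h))) (at x)"
    if "x \<in> S" for x
    using bounded_linear.has_derivative[OF assms(1)] Suc.prems that
    by (auto simp: frechet_derivative_works)
  have "Ck_on k (\<lambda>x. frechet_derivative (\<lambda>x. L (f x)) (at x) h) S" for h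
  proof (subst Ck_on_cong[OF assms(2)])
    show "frechet_derivative (\<lambda>x. L (f x)) (at x) h = L (frechet_derivative f (at x) h)"
      if "x \<in> S" for x
      using frechet_derivative_at[OF der[OF that]] by metis
    show "Ck_on k (\<lambda>x. L (frechet_derivative f (at x) h)) S"
      using Suc.prems by (intro Suc.IH) simp
  qed
  then show ?case
    using der by (auto simp: differentiable_def)
qed

lemma linear_norm_le_sum_Basis:
  fixes L :: "'a::euclidean_space \<Rightarrow> 'b::real_normed_vector"
  assumes "linear L"
  shows "norm (L h) \<le> (\<Sum>k\<in>Basis. norm (L k)) * norm h"
proof -
  have "L h = (\<Sum>k\<in>Basis. (h \<bullet> k) *\<^sub>R L k)"
    using assms by (metis (no_types, lifting) euclidean_representation linear_cmul linear_sum sum.cong)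
  also have "norm \<dots> \<le> (\<Sum>k\<in>Basis. norm (L k) * norm h)"
    by (rule sum_norm_le)
       (use Basis_le_norm in \<open>auto simp: mult.commute[of "\<bar>_\<bar>"] intro!: mult_left_mono\<close>)
  finally show ?thesis by (simp add: sum_distrib_right)
qed

text \<open>Continuity of the derivative is only known direction by direction; summing the bounds for
  the finitely many basis directions gives one constant for all directions.\<close>

lemma C1_derivative_bounded_on_compact:
  fixes f :: "'a::euclidean_space \<Rightarrow> 'b::real_normed_vector"
  assumes "Ck_on 1 f S" "compact K" "K \<subseteq> S"
  obtains C where "C \<ge> 0" "\<And>x h. x \<in> K \<Longrightarrow> norm (frechet_derivative f (at x) h) \<le> C * norm h"
proof -
  have "\<exists>B. \<forall>x\<in>K. norm (frechet_derivative f (at x) k) \<le> B" for k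
  proof -
    have "compact ((\<lambda>x. frechet_derivative f (at x) k) ` K)"
      by (intro compact_continuous_image continuous_on_subset[OF Ck_on_1D(2)[OF assms(1)]] assms)
    then show ?thesis
      using compact_imp_bounded[of "(\<lambda>x. frechet_derivative f (at x) k) ` K"]
      by (auto simp: bounded_iff)
  qed
  then obtain B where B: "\<And>k x. x \<in> K \<Longrightarrow> norm (frechet_derivative f (at x) k) \<le> B k"
    by metis
  show ?thesis
  proof
    show "(\<Sum>k\<in>Basis. \<bar>B k\<bar>) \<ge> 0"
      by (simp add: sum_nonneg)
    fix x h assume "x \<in> K"
    have "linear (frechet_derivative f (at x))"
      using Ck_on_1D(1)[OF assms(1)] \<open>x \<in> K\<close> assms(3)
      by (meson has_derivative_linear subset_eq)
    from linear_norm_le_sum_Basis[OF this, of h]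
    show "norm (frechet_derivative f (at x) h) \<le> (\<Sum>k\<in>Basis. \<bar>B k\<bar>) * norm h"
    proof (rule order_trans, intro mult_right_mono sum_mono)
      fix k :: 'a
      show "norm (frechet_derivative f (at x) k) \<le> \<bar>B k\<bar>"
        using B[OF \<open>x \<in> K\<close>, of k] by linarith
    qed simp
  qed
qed

lemma C1_lipschitz_near_compact:
  fixes f :: "'a::euclidean_space \<Rightarrow> 'b::real_normed_vector"
  assumes "Ck_on 1 f S" "compact K" "(\<Union>x\<in>K. cball x e) \<subseteq> S"
  obtains C where "C \<ge> 0"
    "\<And>x y. x \<in> K \<Longrightarrow> y \<in> cball x e \<Longrightarrow> norm (f y - f x) \<le> C * norm (y - x)"
proof -
  obtain C where C: "C \<ge> 0"
    "\<And>x h. x \<in> (\<Union>x\<in>K. cball x e) \<Longrightarrow> norm (frechet_derivative f (at x) h) \<le> C * norm h"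
    using C1_derivative_bounded_on_compact[OF assms(1) compact_minkowski_sum_cball[OF assms(2)]
        assms(3)] by metis
  show ?thesis
  proof
    fix x y assume *: "x \<in> K" "y \<in> cball x e"
    show "norm (f y - f x) \<le> C * norm (y - x)"
    proof (rule differentiable_bound[OF convex_cball[of x e]])
      fix z assume z: "z \<in> cball x e"
      then show "(f has_derivative frechet_derivative f (at z)) (at z within cball x e)"
        using Ck_on_1D(1)[OF assms(1)] assms(3) * by (blast intro: has_derivative_at_withinI)
      show "onorm (frechet_derivative f (at z)) \<le> C"
        using C(2) z * by (intro onorm_le) blast
    qed (use * in \<open>auto intro: order_trans[OF zero_le_dist]\<close>)
  qed fact
qed

section \<open>Integrals over a box\<close>

lemma has_derivative_integral_parameter:
  fixes f :: "'a::euclidean_space \<Rightarrow> 'b::euclidean_space \<Rightarrow> 'c::euclidean_space"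
  assumes "open U" "x0 \<in> U"
    and der: "\<And>x t. x \<in> U \<Longrightarrow> t \<in> cbox a b \<Longrightarrow> ((\<lambda>x. f x t) has_derivative f' x t) (at x)"
    and int: "\<And>x. x \<in> U \<Longrightarrow> f x integrable_on cbox a b"
    and cont: "\<And>h. continuous_on (U \<times> cbox a b) (\<lambda>(x, t). f' x t h)"
  shows "((\<lambda>x. integral (cbox a b) (f x)) has_derivative
    (\<lambda>h. integral (cbox a b) (\<lambda>t. f' x0 t h))) (at x0)"
proof -
  obtain r where r: "r > 0" "ball x0 r \<subseteq> U"
    using assms(1,2) open_contains_ball by blast
  have lin: "blinfun_apply (Blinfun (f' x t)) = f' x t" if "x \<in> U" "t \<in> cbox a b" for x t
    using der[OF that] by (intro bounded_linear_Blinfun_apply) (rule has_derivative_bounded_linear)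
  have contB: "continuous_on (U \<times> cbox a b) (\<lambda>(x, t). Blinfun (f' x t))"
  proof (rule continuous_on_blinfun_componentwise)
    fix i :: 'a
    show "continuous_on (U \<times> cbox a b) (\<lambda>z. blinfun_apply (case z of (x, t) \<Rightarrow> Blinfun (f' x t)) i)"
      using cont[of i] by (rule continuous_on_eq) (auto simp: lin)
  qed
  have "((\<lambda>x. integral (cbox a b) (f x)) has_derivative
      blinfun_apply (integral (cbox a b) (\<lambda>t. Blinfun (f' x0 t)))) (at x0 within ball x0 r)"
  proof (rule leibniz_rule)
    show "continuous_on (ball x0 r \<times> cbox a b) (\<lambda>(x, t). Blinfun (f' x t))"
      by (rule continuous_on_subset[OF contB]) (use r in auto)
    fix x t assume "x \<in> ball x0 r" "t \<in> cbox a b"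
    with r have "x \<in> U" "t \<in> cbox a b" by blast+
    then show "((\<lambda>x. f x t) has_derivative blinfun_apply (Blinfun (f' x t))) (at x within ball x0 r)"
      using lin[of x t] der[of x t] by (simp add: has_derivative_at_withinI)
  qed (use r int in auto)
  moreover have "blinfun_apply (integral (cbox a b) (\<lambda>t. Blinfun (f' x0 t)))
      = (\<lambda>h. integral (cbox a b) (\<lambda>t. f' x0 t h))"
  proof
    fix h
    have "continuous_on (cbox a b) (\<lambda>t. Blinfun (f' x0 t))"
      using continuous_on_compose2[OF contB continuous_on_Pair[OF
            continuous_on_const[of "cbox a b" x0] continuous_on_id]] assms(2) by auto
    then show "blinfun_apply (integral (cbox a b) (\<lambda>t. Blinfun (f' x0 t))) h
        = integral (cbox a b) (\<lambda>t. f' x0 t h)"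
      using assms(2) by (subst blinfun_apply_integral)
        (auto intro!: integrable_continuous integral_cong simp: lin)
  qed
  ultimately show ?thesis
    using at_within_open[of x0 "ball x0 r"] r by simp
qed

lemma lborel_integral_eq_integral_cbox:
  fixes f :: "'a::euclidean_space \<Rightarrow> 'b::euclidean_space"
  assumes "continuous_on (cbox a b) f" "\<And>x. x \<notin> cbox a b \<Longrightarrow> f x = 0"
  shows "(LINT x|lborel. f x) = integral (cbox a b) f"
proof -
  have "set_integrable lborel (cbox a b) f"
    unfolding set_integrable_def by (intro borel_integrable_compact assms) simp
  moreover have "(LINT x:cbox a b|lborel. f x) = (LINT x|lborel. f x)"
    unfolding set_lebesgue_integral_def
    by (intro Bochner_Integration.integral_cong) (use assms(2) in \<open>auto simp: indicator_def\<close>)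
  ultimately show ?thesis
    using set_borel_integral_eq_integral(2) by metis
qed

text \<open>The averages \<open>\<integral> \<psi>(z) f(x - l z) dz\<close> are the convolutions with the rescaled kernel, written on
  a fixed box \<open>B\<close> that contains the support of the kernel. Only the values of \<open>f\<close> on \<open>x - l B\<close>
  enter.\<close>

definition average ::
    "'a::euclidean_space set \<Rightarrow> ('a \<Rightarrow> real) \<Rightarrow> ('a \<Rightarrow> 'b::euclidean_space) \<Rightarrow> real \<Rightarrow> 'a \<Rightarrow> 'b" where
  "average B \<psi> f l x = integral B (\<lambda>z. \<psi> z *\<^sub>R f (x - l *\<^sub>R z))"

lemma average_cong:
  assumes "\<And>z. z \<in> B \<Longrightarrow> f (x - l *\<^sub>R z) = g (x - l *\<^sub>R z)"
  shows "average B \<psi> f l x = average B \<psi> g l x"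
  unfolding average_def by (intro integral_cong) (simp add: assms)

lemma average_continuous_on_integrand:
  fixes f :: "'a::real_normed_vector \<Rightarrow> 'b::real_normed_vector"
  assumes "continuous_on B \<psi>" "continuous_on S f" "\<And>z. z \<in> B \<Longrightarrow> x - l *\<^sub>R z \<in> S"
  shows "continuous_on B (\<lambda>z. \<psi> z *\<^sub>R f (x - l *\<^sub>R z))"
  by (intro continuous_intros assms(1) continuous_on_compose2[OF assms(2)]) (use assms(3) in auto)

lemma average_integrable:
  fixes f :: "'a::euclidean_space \<Rightarrow> 'b::euclidean_space"
  assumes "continuous_on (cbox a b) \<psi>" "continuous_on S f"
    "\<And>z. z \<in> cbox a b \<Longrightarrow> x - l *\<^sub>R z \<in> S"
  shows "(\<lambda>z. \<psi> z *\<^sub>R f (x - l *\<^sub>R z)) integrable_on cbox a b"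
  by (intro integrable_continuous average_continuous_on_integrand[OF assms])

lemma average_norm_le:
  assumes "continuous_on (cbox a b) \<psi>" "continuous_on S f"
    "\<And>z. z \<in> cbox a b \<Longrightarrow> x - l *\<^sub>R z \<in> S"
    and "\<And>z. z \<in> cbox a b \<Longrightarrow> \<bar>\<psi> z\<bar> \<le> N" "\<And>z. z \<in> cbox a b \<Longrightarrow> norm (f (x - l *\<^sub>R z)) \<le> E"
    and "N \<ge> 0" "E \<ge> 0"
  shows "norm (average (cbox a b) \<psi> f l x) \<le> N * E * measure lborel (cbox a b)"
  unfolding average_def
proof (rule has_integral_bound)
  show "0 \<le> N * E" using assms by simp
  show "norm (\<psi> z *\<^sub>R f (x - l *\<^sub>R z)) \<le> N * E" if "z \<in> cbox a b" for z
    using that assms by (simp add: mult_mono)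
qed (use average_integrable[OF assms(1-3)] in \<open>simp add: integrable_integral\<close>)

lemma average_continuous_on:
  assumes "continuous_on (cbox a b) \<psi>" "continuous_on S f"
    "\<And>x z. x \<in> U \<Longrightarrow> z \<in> cbox a b \<Longrightarrow> x - l *\<^sub>R z \<in> S"
  shows "continuous_on U (average (cbox a b) \<psi> f l)"
  unfolding average_def
proof (rule integral_continuous_on_param)
  show "continuous_on (U \<times> cbox a b) (\<lambda>(x, z). \<psi> z *\<^sub>R f (x - l *\<^sub>R z))"
    unfolding case_prod_beta
    by (intro continuous_intros continuous_on_compose2[OF assms(1)] continuous_on_compose2[OF assms(2)])
       (use assms(3) in auto)
qed

lemma average_has_derivative_C1:
  assumes "continuous_on (cbox a b) \<psi>" "Ck_on 1 f S" "open U" "x \<in> U"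
    "\<And>x z. x \<in> U \<Longrightarrow> z \<in> cbox a b \<Longrightarrow> x - l *\<^sub>R z \<in> S"
  shows "(average (cbox a b) \<psi> f l has_derivative
    (\<lambda>h. average (cbox a b) \<psi> (\<lambda>y. frechet_derivative f (at y) h) l x)) (at x)"
  unfolding average_def
proof (rule has_derivative_integral_parameter[OF assms(3,4)])
  fix x z assume xz: "x \<in> U" "z \<in> cbox a b"
  have "((\<lambda>x. f (x - l *\<^sub>R z)) has_derivative frechet_derivative f (at (x - l *\<^sub>R z))) (at x)"
    by (rule has_derivative_compose[of "\<lambda>x. x - l *\<^sub>R z" "\<lambda>h. h" x UNIV f, OF _
          Ck_on_1D(1)[OF assms(2) assms(5)[OF xz]]])
       (auto intro!: derivative_eq_intros)
  then show "((\<lambda>x. \<psi> z *\<^sub>R f (x - l *\<^sub>R z)) has_derivative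
      (\<lambda>h. \<psi> z *\<^sub>R frechet_derivative f (at (x - l *\<^sub>R z)) h)) (at x)"
    by (rule has_derivative_scaleR_right)
next
  fix x assume "x \<in> U"
  then show "(\<lambda>z. \<psi> z *\<^sub>R f (x - l *\<^sub>R z)) integrable_on cbox a b"
    using average_integrable[OF assms(1) Ck_on_1D(3)[OF assms(2)]] assms(5) by blast
next
  fix h
  show "continuous_on (U \<times> cbox a b)
      (\<lambda>(x, z). \<psi> z *\<^sub>R frechet_derivative f (at (x - l *\<^sub>R z)) h)"
    unfolding case_prod_beta
    by (intro continuous_intros continuous_on_compose2[OF assms(1)]
        continuous_on_compose2[OF Ck_on_1D(2)[OF assms(2)]]) (use assms(5) in auto)
qed

text \<open>The substitution \<open>y = x - l z\<close>; the box \<open>cbox c d\<close> can serve all nearby \<open>x\<close>, so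
  that \<open>x\<close> occurs in the kernel only.\<close>

lemma average_substitution:
  fixes \<psi> :: "'a::euclidean_space \<Rightarrow> real" and f :: "'a \<Rightarrow> 'b::euclidean_space"
  assumes "continuous_on UNIV f" "continuous_on UNIV \<psi>" "l > 0"
    and "\<And>z. z \<notin> cbox a b \<Longrightarrow> \<psi> z = 0" "\<And>z. z \<in> cbox a b \<Longrightarrow> x - l *\<^sub>R z \<in> cbox c d"
  shows "average (cbox a b) \<psi> f l x
    = (1 / l ^ DIM('a)) *\<^sub>R integral (cbox c d) (\<lambda>y. \<psi> ((x - y) /\<^sub>R l) *\<^sub>R f y)"
proof -
  let ?k = "\<lambda>y. \<psi> ((x - y) /\<^sub>R l) *\<^sub>R f y"
  have "continuous_on (cbox c d) ?k"
    by (intro continuous_intros continuous_on_compose2[OF assms(2)] continuous_on_subset[OF assms(1)])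
      auto
  then have "(?k has_integral integral (cbox c d) ?k) (cbox c d)"
    by (intro integrable_integral integrable_continuous)
  from has_integral_affinity[OF this, of "- l" x] assms(3)
  have *: "((\<lambda>z. ?k (x - l *\<^sub>R z)) has_integral (1 / l ^ DIM('a)) *\<^sub>R integral (cbox c d) ?k)
      ((\<lambda>y. (1 / - l) *\<^sub>R y + - ((1 / - l) *\<^sub>R x)) ` cbox c d)" (is "(_ has_integral _) ?T")
    by simp
  have **: "((\<lambda>z. \<psi> z *\<^sub>R f (x - l *\<^sub>R z)) has_integral average (cbox a b) \<psi> f l x) (cbox a b)"
    unfolding average_def
    by (intro integrable_integral average_integrable[where S=UNIV] continuous_on_subset[OF assms(2)] assms(1))
       auto
  have "cbox a b \<subseteq> ?T"
  proof
    fix z assume "z \<in> cbox a b"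
    from assms(5)[OF this] show "z \<in> ?T"
      using assms(3) by (intro image_eqI[of _ _ "x - l *\<^sub>R z"]) (auto simp: algebra_simps)
  qed
  from has_integral_on_superset[OF ** _ this] assms(4)
  have "((\<lambda>z. \<psi> z *\<^sub>R f (x - l *\<^sub>R z)) has_integral average (cbox a b) \<psi> f l x) ?T"
    by simp
  moreover have "(\<lambda>z. ?k (x - l *\<^sub>R z)) = (\<lambda>z. \<psi> z *\<^sub>R f (x - l *\<^sub>R z))"
    using assms(3) by auto
  ultimately show ?thesis
    using has_integral_unique[OF _ *] by simp
qed

lemma average_minus_const:
  fixes f :: "'a::euclidean_space \<Rightarrow> 'b::euclidean_space"
  assumes "continuous_on (cbox a b) \<psi>" "continuous_on S f"
    "\<And>z. z \<in> cbox a b \<Longrightarrow> x - l *\<^sub>R z \<in> S"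
  shows "average (cbox a b) \<psi> (\<lambda>y. f y - p) l x
    = average (cbox a b) \<psi> f l x - integral (cbox a b) \<psi> *\<^sub>R p"
proof -
  have "((\<lambda>z. \<psi> z *\<^sub>R f (x - l *\<^sub>R z) - \<psi> z *\<^sub>R p) has_integral
      average (cbox a b) \<psi> f l x - integral (cbox a b) \<psi> *\<^sub>R p) (cbox a b)"
    unfolding average_def
    by (intro has_integral_diff has_integral_scaleR_left integrable_integral
        average_integrable[OF assms] integrable_continuous assms(1))
  then show ?thesis
    unfolding average_def by (intro integral_unique) (simp add: scaleR_diff_right)
qed

text \<open>Polarisation around constants \<open>p\<close> and \<open>q\<close>: for a kernel of mean one this exhibits the
  commutator of averaging with the product as quadratic in the oscillations of the two factors, and
  for a kernel of mean zero it gives the corresponding fact for the derivative of the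
  commutator.\<close>

lemma average_inner_expansion:
  fixes F H :: "'a::euclidean_space \<Rightarrow> 'b::euclidean_space"
  assumes \<psi>: "continuous_on (cbox a b) \<psi>" and F: "continuous_on S F" and H: "continuous_on S H"
    and sub: "\<And>z. z \<in> cbox a b \<Longrightarrow> x - l *\<^sub>R z \<in> S"
  shows "average (cbox a b) \<psi> (\<lambda>y. F y \<bullet> H y) l x
    = average (cbox a b) \<psi> (\<lambda>y. (F y - p) \<bullet> (H y - q)) l x
      + average (cbox a b) \<psi> F l x \<bullet> q + p \<bullet> average (cbox a b) \<psi> H l x
      - integral (cbox a b) \<psi> * (p \<bullet> q)"
proof -
  let ?y = "\<lambda>z. x - l *\<^sub>R z"
  have "continuous_on S (\<lambda>y. (F y - p) \<bullet> (H y - q))"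
    by (intro continuous_intros F H)
  from average_integrable[OF \<psi> this sub]
  have 1: "((\<lambda>z. \<psi> z *\<^sub>R ((F (?y z) - p) \<bullet> (H (?y z) - q))) has_integral
      average (cbox a b) \<psi> (\<lambda>y. (F y - p) \<bullet> (H y - q)) l x) (cbox a b)"
    unfolding average_def by (simp add: integrable_integral)
  have 2: "((\<lambda>z. (\<psi> z *\<^sub>R F (?y z)) \<bullet> q) has_integral average (cbox a b) \<psi> F l x \<bullet> q) (cbox a b)"
    using has_integral_linear[OF integrable_integral[OF average_integrable[OF \<psi> F sub]]
        bounded_linear_inner_left[of q]]
    unfolding average_def o_def by simp
  have 3: "((\<lambda>z. p \<bullet> (\<psi> z *\<^sub>R H (?y z))) has_integral p \<bullet> average (cbox a b) \<psi> H l x) (cbox a b)"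
    using has_integral_linear[OF integrable_integral[OF average_integrable[OF \<psi> H sub]]
        bounded_linear_inner_right[of p]]
    unfolding average_def o_def by simp
  have 4: "((\<lambda>z. \<psi> z * (p \<bullet> q)) has_integral integral (cbox a b) \<psi> * (p \<bullet> q)) (cbox a b)"
    by (intro has_integral_mult_left integrable_integral integrable_continuous \<psi>)
  have "(\<lambda>z. \<psi> z *\<^sub>R ((F (?y z) - p) \<bullet> (H (?y z) - q)) + (\<psi> z *\<^sub>R F (?y z)) \<bullet> q
      + p \<bullet> (\<psi> z *\<^sub>R H (?y z)) - \<psi> z * (p \<bullet> q)) = (\<lambda>z. \<psi> z *\<^sub>R (F (?y z) \<bullet> H (?y z)))"
    by (auto simp: algebra_simps inner_diff_left inner_diff_right)
  then show ?thesis
    using has_integral_diff[OF has_integral_add[OF has_integral_add[OF 1 2] 3] 4]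
    by (subst average_def) (auto intro: integral_unique)
qed

lemma average_diff_const_norm_le:
  fixes f :: "'a::euclidean_space \<Rightarrow> 'b::euclidean_space"
  assumes "continuous_on (cbox a b) \<psi>" "continuous_on S f"
    "\<And>z. z \<in> cbox a b \<Longrightarrow> x - l *\<^sub>R z \<in> S"
    and "\<And>z. z \<in> cbox a b \<Longrightarrow> \<bar>\<psi> z\<bar> \<le> N"
    and "\<And>z. z \<in> cbox a b \<Longrightarrow> norm (f (x - l *\<^sub>R z) - p) \<le> E" and "N \<ge> 0" "E \<ge> 0"
  shows "norm (average (cbox a b) \<psi> f l x - integral (cbox a b) \<psi> *\<^sub>R p)
    \<le> N * E * measure lborel (cbox a b)"
proof -
  have "norm (average (cbox a b) \<psi> (\<lambda>y. f y - p) l x) \<le> N * E * measure lborel (cbox a b)"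
    by (rule average_norm_le[where S=S]) (use assms in \<open>auto intro!: continuous_intros\<close>)
  then show ?thesis
    by (simp add: average_minus_const[OF assms(1-3)])
qed

lemma average_inner_diff_norm_le:
  fixes F H :: "'a::euclidean_space \<Rightarrow> 'b::euclidean_space"
  assumes "continuous_on (cbox a b) \<psi>" "continuous_on S F" "continuous_on S H"
    "\<And>z. z \<in> cbox a b \<Longrightarrow> x - l *\<^sub>R z \<in> S"
    and "\<And>z. z \<in> cbox a b \<Longrightarrow> \<bar>\<psi> z\<bar> \<le> N"
    and "\<And>z. z \<in> cbox a b \<Longrightarrow> norm (F (x - l *\<^sub>R z) - p) \<le> E"
    and "\<And>z. z \<in> cbox a b \<Longrightarrow> norm (H (x - l *\<^sub>R z) - q) \<le> E" and "N \<ge> 0" "E \<ge> 0"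
  shows "\<bar>average (cbox a b) \<psi> (\<lambda>y. (F y - p) \<bullet> (H y - q)) l x\<bar>
    \<le> N * (E * E) * measure lborel (cbox a b)"
proof -
  have "norm (average (cbox a b) \<psi> (\<lambda>y. (F y - p) \<bullet> (H y - q)) l x)
    \<le> N * (E * E) * measure lborel (cbox a b)"
  proof (rule average_norm_le[where S=S])
    show "norm ((F (x - l *\<^sub>R z) - p) \<bullet> (H (x - l *\<^sub>R z) - q)) \<le> E * E" if "z \<in> cbox a b" for z
      using order_trans[OF Cauchy_Schwarz_ineq2 mult_mono[OF assms(6)[OF that] assms(7)[OF that]]]
        assms(9) by simp
  qed (use assms in \<open>auto intro!: continuous_intros\<close>)
  then show ?thesis by simp
qed

section \<open>Mollification with a differentiable kernel\<close>

locale smoothing_kernel =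
  fixes \<phi> :: "'a::euclidean_space \<Rightarrow> real" and a b :: 'a
  assumes C1: "Ck_on 1 \<phi> UNIV"
    and vanishes: "\<And>z. z \<notin> cbox a b \<Longrightarrow> \<phi> z = 0"
    and mean_one: "integral (cbox a b) \<phi> = 1"
begin

abbreviation mollify :: "('a \<Rightarrow> 'b::euclidean_space) \<Rightarrow> real \<Rightarrow> 'a \<Rightarrow> 'b" where
  "mollify \<equiv> average (cbox a b) \<phi>"

abbreviation dkernel :: "'a \<Rightarrow> 'a \<Rightarrow> real" where
  "dkernel h z \<equiv> frechet_derivative \<phi> (at z) h"

lemma kernel_has_derivative: "(\<phi> has_derivative (\<lambda>h. dkernel h z)) (at z)"
  using Ck_on_1D(1)[OF C1] by simp

lemma kernel_continuous: "continuous_on S \<phi>"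
  using Ck_on_1D(3)[OF C1] continuous_on_subset by blast

lemma dkernel_continuous: "continuous_on S (dkernel h)"
  using Ck_on_1D(2)[OF C1] continuous_on_subset by blast

lemma dkernel_vanishes:
  assumes "z \<notin> cbox a b"
  shows "dkernel h z = 0"
proof -
  have "(\<phi> has_derivative (\<lambda>_. 0)) (at z)"
    by (rule has_derivative_transform_within_open[of "\<lambda>_. 0" _ _ _ "- cbox a b"])
       (use assms vanishes in \<open>auto intro: closed_cbox\<close>)
  from has_derivative_unique[OF this kernel_has_derivative] show ?thesis
    by metis
qed

text \<open>For merely continuous \<open>f\<close> the derivative falls on the kernel: after the substitution
  \<open>y = x - l z\<close> only the kernel depends on \<open>x\<close>, and substituting back leaves the factor \<open>1 / l\<close>.
  Extending \<open>f\<close> continuously to the whole space allows the \<open>y\<close>-integral to be taken over a box.\<close>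

lemma mollify_has_derivative:
  fixes f :: "'a \<Rightarrow> 'b::euclidean_space"
  assumes f: "continuous_on S f" and "closed S" and U: "open U" "x0 \<in> U" and l: "l > 0"
    and sub: "\<And>x z. x \<in> U \<Longrightarrow> z \<in> cbox a b \<Longrightarrow> x - l *\<^sub>R z \<in> S"
  shows "(mollify f l has_derivative (\<lambda>h. (1 / l) *\<^sub>R average (cbox a b) (dkernel h) f l x0)) (at x0)"
proof -
  obtain F where F: "continuous_on UNIV F" "\<And>x. x \<in> S \<Longrightarrow> F x = f x"
    using Tietze_unbounded[OF f, of UNIV] \<open>closed S\<close> by auto
  have avg_F: "average (cbox a b) \<psi> F l x = average (cbox a b) \<psi> f l x" if "x \<in> U" for \<psi> x
    using that sub F(2) by (intro average_cong) auto
  \<comment> \<open>A bounded neighbourhood of \<open>x0\<close>, so that one box contains \<open>x - l B\<close> for all its points \<open>x\<close>.\<close>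
  define W where "W = U \<inter> ball x0 1"
  have W: "open W" "x0 \<in> W" "W \<subseteq> U"
    using U by (auto simp: W_def)
  obtain R where R: "\<And>z. z \<in> cbox a b \<Longrightarrow> norm z \<le> R"
    using bounded_cbox[of a b] by (auto simp: bounded_iff)
  obtain c where c: "cball x0 (1 + l * R) \<subseteq> cbox (- c) c"
    using bounded_subset_cbox_symmetric[OF bounded_cball] by metis
  have box: "x - l *\<^sub>R z \<in> cbox (- c) c" if "x \<in> W" "z \<in> cbox a b" for x z
  proof -
    have "dist x0 (x - l *\<^sub>R z) \<le> dist x0 x + norm (l *\<^sub>R z)"
      by (metis diff_add_cancel dist_norm dist_triangle
          add_diff_cancel_left')
    also have "\<dots> \<le> 1 + l * R"
      using that R[of z] l by (intro add_mono) (auto simp: W_def)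
    finally show ?thesis using c by auto
  qed
  let ?n = "l ^ DIM('a)"
  have subst: "average (cbox a b) \<psi> F l x
      = (1 / ?n) *\<^sub>R integral (cbox (- c) c) (\<lambda>y. \<psi> ((x - y) /\<^sub>R l) *\<^sub>R F y)"
    if "continuous_on UNIV \<psi>" "\<And>z. z \<notin> cbox a b \<Longrightarrow> \<psi> z = 0" "x \<in> W" for \<psi> x
    by (rule average_substitution[OF F(1) that(1) l that(2) box[OF that(3)]])
  have "((\<lambda>x. integral (cbox (- c) c) (\<lambda>y. \<phi> ((x - y) /\<^sub>R l) *\<^sub>R F y)) has_derivative
      (\<lambda>h. integral (cbox (- c) c) (\<lambda>y. dkernel (h /\<^sub>R l) ((x0 - y) /\<^sub>R l) *\<^sub>R F y))) (at x0)"
  proof (rule has_derivative_integral_parameter[OF W(1,2)])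
    fix x y
    show "((\<lambda>x. \<phi> ((x - y) /\<^sub>R l) *\<^sub>R F y) has_derivative
        (\<lambda>h. dkernel (h /\<^sub>R l) ((x - y) /\<^sub>R l) *\<^sub>R F y)) (at x)"
      by (rule has_derivative_scaleR_left,
          rule has_derivative_compose[of "\<lambda>x. (x - y) /\<^sub>R l" "\<lambda>h. h /\<^sub>R l" x UNIV \<phi>,
            OF _ kernel_has_derivative])
         (auto intro!: derivative_eq_intros)
  next
    fix x
    show "(\<lambda>y. \<phi> ((x - y) /\<^sub>R l) *\<^sub>R F y) integrable_on cbox (- c) c"
      by (intro integrable_continuous continuous_intros continuous_on_subset[OF F(1)]
          continuous_on_compose2[OF kernel_continuous[of UNIV]]) auto
  next
    fix h
    show "continuous_on (W \<times> cbox (- c) c)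
        (\<lambda>(x, y). dkernel (h /\<^sub>R l) ((x - y) /\<^sub>R l) *\<^sub>R F y)"
      unfolding case_prod_beta
      by (intro continuous_intros continuous_on_compose2[OF F(1)]
          continuous_on_compose2[OF dkernel_continuous[of UNIV]]) auto
  qed
  from has_derivative_scaleR_right[OF this, of "1 / ?n"]
  have "((\<lambda>x. (1 / ?n) *\<^sub>R integral (cbox (- c) c) (\<lambda>y. \<phi> ((x - y) /\<^sub>R l) *\<^sub>R F y)) has_derivative
      (\<lambda>h. (1 / ?n) *\<^sub>R integral (cbox (- c) c)
        (\<lambda>y. dkernel (h /\<^sub>R l) ((x0 - y) /\<^sub>R l) *\<^sub>R F y))) (at x0)" .
  then have "(mollify f l has_derivative
      (\<lambda>h. (1 / ?n) *\<^sub>R integral (cbox (- c) c)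
        (\<lambda>y. dkernel (h /\<^sub>R l) ((x0 - y) /\<^sub>R l) *\<^sub>R F y))) (at x0)"
  proof (rule has_derivative_transform_within_open[OF _ W(1,2)])
    fix x assume "x \<in> W"
    then show "(1 / ?n) *\<^sub>R integral (cbox (- c) c) (\<lambda>y. \<phi> ((x - y) /\<^sub>R l) *\<^sub>R F y) = mollify f l x"
      using subst[OF kernel_continuous vanishes \<open>x \<in> W\<close>] avg_F[of x \<phi>] W(3) by (metis subsetD)
  qed
  moreover have "(1 / ?n) *\<^sub>R integral (cbox (- c) c)
        (\<lambda>y. dkernel (h /\<^sub>R l) ((x0 - y) /\<^sub>R l) *\<^sub>R F y)
      = (1 / l) *\<^sub>R average (cbox a b) (dkernel h) f l x0" for h
  proof -
    have "dkernel (h /\<^sub>R l) z = (1 / l) * dkernel h z" for z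
      using linear_cmul[OF has_derivative_linear[OF kernel_has_derivative[of z]], of "inverse l" h]
      by (simp add: divide_inverse)
    then have "average (cbox a b) (dkernel (h /\<^sub>R l)) f l x0
        = integral (cbox a b) (\<lambda>z. (1 / l) *\<^sub>R (dkernel h z *\<^sub>R f (x0 - l *\<^sub>R z)))"
      unfolding average_def by (intro integral_cong) simp
    also have "\<dots> = (1 / l) *\<^sub>R average (cbox a b) (dkernel h) f l x0"
      unfolding average_def by (rule integral_cmul)
    finally show ?thesis
      using subst[OF dkernel_continuous dkernel_vanishes W(2), of "h /\<^sub>R l"] avg_F[OF U(2)] by simp
  qed
  ultimately show ?thesis by simp
qed

text \<open>The mollification of the constant \<open>1\<close> is constant, so its derivative, which is the mean of the
  differentiated kernel, vanishes.\<close>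

lemma dkernel_mean_zero: "integral (cbox a b) (dkernel h) = 0"
proof -
  have "(mollify (\<lambda>_. 1::real) 1 has_derivative
      (\<lambda>h. (1 / 1) *\<^sub>R average (cbox a b) (dkernel h) (\<lambda>_. 1) 1 0)) (at 0)"
    by (rule mollify_has_derivative[where S=UNIV and U=UNIV]) auto
  moreover have "mollify (\<lambda>_. 1::real) 1 = (\<lambda>_. 1)"
    using mean_one by (auto simp: average_def)
  ultimately have "(\<lambda>h. average (cbox a b) (dkernel h) (\<lambda>_. 1::real) 1 0) = (\<lambda>_. 0)"
    using has_derivative_unique[of "\<lambda>_. 1::real" _ 0 "\<lambda>_. 0"] by simp
  from fun_cong[OF this, of h] show ?thesis
    by (simp add: average_def)
qed

lemma kernel_bounded:
  obtains N where "N \<ge> 0" "\<And>z. z \<in> cbox a b \<Longrightarrow> \<bar>\<phi> z\<bar> \<le> N"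
proof -
  have "bounded (\<phi> ` cbox a b)"
    by (intro compact_imp_bounded compact_continuous_image kernel_continuous compact_cbox)
  then obtain N where N: "\<And>z. z \<in> cbox a b \<Longrightarrow> \<bar>\<phi> z\<bar> \<le> N"
    by (auto simp: bounded_iff)
  show ?thesis
    using that[of "\<bar>N\<bar>"] N by force
qed

lemma commutator_norm_le:
  fixes F H :: "'a \<Rightarrow> 'b::euclidean_space"
  assumes F: "continuous_on S F" and H: "continuous_on S H"
    and sub: "\<And>z. z \<in> cbox a b \<Longrightarrow> x - l *\<^sub>R z \<in> S"
    and N: "\<And>z. z \<in> cbox a b \<Longrightarrow> \<bar>\<phi> z\<bar> \<le> N" "N \<ge> 0"
    and EF: "\<And>z. z \<in> cbox a b \<Longrightarrow> norm (F (x - l *\<^sub>R z) - F x) \<le> E"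
    and EH: "\<And>z. z \<in> cbox a b \<Longrightarrow> norm (H (x - l *\<^sub>R z) - H x) \<le> E" and "E \<ge> 0"
  defines "V \<equiv> measure lborel (cbox a b)"
  shows "\<bar>mollify F l x \<bullet> mollify H l x - mollify (\<lambda>y. F y \<bullet> H y) l x\<bar>
    \<le> ((N * V)\<^sup>2 + N * V) * E\<^sup>2"
proof -
  let ?P = "mollify F l x - F x" and ?Q = "mollify H l x - H x"
  let ?T = "mollify (\<lambda>y. (F y - F x) \<bullet> (H y - H x)) l x"
  have "mollify F l x \<bullet> mollify H l x - mollify (\<lambda>y. F y \<bullet> H y) l x = ?P \<bullet> ?Q - ?T"
  proof -
    have "?P \<bullet> ?Q = mollify F l x \<bullet> mollify H l x - mollify F l x \<bullet> H x - F x \<bullet> mollify H l x + F x \<bullet> H x"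
      by (simp add: inner_diff_left inner_diff_right)
    then show ?thesis
      using average_inner_expansion[OF kernel_continuous F H sub, where p="F x" and q="H x"]
      by (simp add: mean_one)
  qed
  moreover have "norm ?P \<le> N * E * V" "norm ?Q \<le> N * E * V"
    using average_diff_const_norm_le[where a=a and b=b, OF kernel_continuous F sub N(1) EF N(2) \<open>E \<ge> 0\<close>]
      average_diff_const_norm_le[where a=a and b=b, OF kernel_continuous H sub N(1) EH N(2) \<open>E \<ge> 0\<close>]
    by (simp_all add: mean_one V_def)
  then have "\<bar>?P \<bullet> ?Q\<bar> \<le> (N * E * V) * (N * E * V)"
    by (intro order_trans[OF Cauchy_Schwarz_ineq2] mult_mono) (auto intro: order_trans[OF norm_ge_zero])
  moreover have "\<bar>?T\<bar> \<le> N * (E * E) * V"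
    unfolding V_def by (rule average_inner_diff_norm_le[OF kernel_continuous F H sub N(1) EF EH N(2) \<open>E \<ge> 0\<close>])
  ultimately show ?thesis
    by (simp add: power2_eq_square algebra_simps)
qed

text \<open>Product rule for the commutator, up to the factor \<open>1 / l\<close>. As the differentiated kernel has
  mean zero, its averages of \<open>F\<close> and \<open>H\<close> are already of the size of the oscillations.\<close>

lemma commutator_derivative_norm_le:
  fixes F H :: "'a \<Rightarrow> 'b::euclidean_space"
  assumes F: "continuous_on S F" and H: "continuous_on S H"
    and sub: "\<And>z. z \<in> cbox a b \<Longrightarrow> x - l *\<^sub>R z \<in> S"
    and N: "\<And>z. z \<in> cbox a b \<Longrightarrow> \<bar>\<phi> z\<bar> \<le> N" "N \<ge> 0"
    and M: "\<And>z. z \<in> cbox a b \<Longrightarrow> \<bar>dkernel h z\<bar> \<le> M" "M \<ge> 0"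
    and EF: "\<And>z. z \<in> cbox a b \<Longrightarrow> norm (F (x - l *\<^sub>R z) - F x) \<le> E"
    and EH: "\<And>z. z \<in> cbox a b \<Longrightarrow> norm (H (x - l *\<^sub>R z) - H x) \<le> E" and "E \<ge> 0"
  defines "V \<equiv> measure lborel (cbox a b)"
  shows "\<bar>mollify F l x \<bullet> average (cbox a b) (dkernel h) H l x
      + average (cbox a b) (dkernel h) F l x \<bullet> mollify H l x
      - average (cbox a b) (dkernel h) (\<lambda>y. F y \<bullet> H y) l x\<bar>
    \<le> (2 * N * V\<^sup>2 + V) * M * E\<^sup>2"
proof -
  let ?A = "average (cbox a b) (dkernel h)"
  let ?P = "mollify F l x - F x" and ?Q = "mollify H l x - H x"
  let ?T = "?A (\<lambda>y. (F y - F x) \<bullet> (H y - H x)) l x"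
  have expansion: "mollify F l x \<bullet> ?A H l x + ?A F l x \<bullet> mollify H l x - ?A (\<lambda>y. F y \<bullet> H y) l x
      = ?P \<bullet> ?A H l x + ?A F l x \<bullet> ?Q - ?T"
  proof -
    have "?P \<bullet> ?A H l x = mollify F l x \<bullet> ?A H l x - F x \<bullet> ?A H l x"
      "?A F l x \<bullet> ?Q = ?A F l x \<bullet> mollify H l x - ?A F l x \<bullet> H x"
      by (simp_all add: inner_diff_left inner_diff_right)
    then show ?thesis
      using average_inner_expansion[OF dkernel_continuous F H sub, where p="F x" and q="H x"]
      by (simp add: dkernel_mean_zero)
  qed
  have "norm ?P \<le> N * E * V" "norm ?Q \<le> N * E * V"
    using average_diff_const_norm_le[where a=a and b=b, OF kernel_continuous F sub N(1) EF N(2) \<open>E \<ge> 0\<close>]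
      average_diff_const_norm_le[where a=a and b=b, OF kernel_continuous H sub N(1) EH N(2) \<open>E \<ge> 0\<close>]
    by (simp_all add: mean_one V_def)
  moreover have "norm (?A F l x) \<le> M * E * V" "norm (?A H l x) \<le> M * E * V"
    using average_diff_const_norm_le[where a=a and b=b, OF dkernel_continuous F sub M(1) EF M(2) \<open>E \<ge> 0\<close>]
      average_diff_const_norm_le[where a=a and b=b, OF dkernel_continuous H sub M(1) EH M(2) \<open>E \<ge> 0\<close>]
    by (simp_all add: dkernel_mean_zero V_def)
  ultimately have "\<bar>?P \<bullet> ?A H l x\<bar> \<le> (N * E * V) * (M * E * V)"
    "\<bar>?A F l x \<bullet> ?Q\<bar> \<le> (M * E * V) * (N * E * V)"
    by (auto intro!: order_trans[OF Cauchy_Schwarz_ineq2] mult_mono intro: order_trans[OF norm_ge_zero])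
  moreover have "\<bar>?T\<bar> \<le> M * (E * E) * V"
    unfolding V_def
    by (rule average_inner_diff_norm_le[OF dkernel_continuous F H sub M(1) EF EH M(2) \<open>E \<ge> 0\<close>])
  moreover note expansion
  ultimately show ?thesis
    by (simp add: power2_eq_square algebra_simps)
qed

end

section \<open>Estimates in the norm of continuously differentiable maps\<close>

text \<open>A bound of size \<open>\<epsilon>\<close> on \<open>f\<close> and on its derivative over \<open>K\<close>, with \<open>f\<close> continuously
  differentiable on \<open>U\<close>. Pointwise bounds, unlike suprema, add up without a check that the
  suprema are over bounded sets, and testing the derivative on vectors avoids operator norms.\<close>

definition C1_bound_with ::
    "'a::euclidean_space set \<Rightarrow> 'a set \<Rightarrow> ('a \<Rightarrow> 'b::real_normed_vector) \<Rightarrow> ('a \<Rightarrow> 'a \<Rightarrow> 'b) \<Rightarrow>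
      real \<Rightarrow> bool" where
  "C1_bound_with U K f D \<epsilon> \<longleftrightarrow> (\<forall>x\<in>U. (f has_derivative D x) (at x)) \<and>
     (\<forall>h. continuous_on U (\<lambda>x. D x h)) \<and>
     (\<forall>x\<in>K. norm (f x) \<le> \<epsilon>) \<and> (\<forall>x\<in>K. \<forall>h. norm (D x h) \<le> \<epsilon> * norm h)"

definition C1_bound ::
    "'a::euclidean_space set \<Rightarrow> 'a set \<Rightarrow> ('a \<Rightarrow> 'b::real_normed_vector) \<Rightarrow> real \<Rightarrow> bool" where
  "C1_bound U K f \<epsilon> \<longleftrightarrow> (\<exists>D. C1_bound_with U K f D \<epsilon>)"

lemma C1_bound_withD:
  assumes "C1_bound_with U K f D \<epsilon>"
  shows "x \<in> U \<Longrightarrow> (f has_derivative D x) (at x)" "continuous_on U (\<lambda>x. D x h)"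
    "x \<in> K \<Longrightarrow> norm (f x) \<le> \<epsilon>" "x \<in> K \<Longrightarrow> norm (D x h) \<le> \<epsilon> * norm h"
  using assms by (simp_all add: C1_bound_with_def)

lemma C1_boundI:
  assumes "\<And>x. x \<in> U \<Longrightarrow> (f has_derivative D x) (at x)" "\<And>h. continuous_on U (\<lambda>x. D x h)"
    "\<And>x. x \<in> K \<Longrightarrow> norm (f x) \<le> \<epsilon>" "\<And>x h. x \<in> K \<Longrightarrow> norm (D x h) \<le> \<epsilon> * norm h"
  shows "C1_bound U K f \<epsilon>"
  unfolding C1_bound_def C1_bound_with_def
  by (intro exI[of _ D] conjI ballI allI) (simp_all add: assms)

lemma C1_bound_mono:
  assumes "C1_bound U K f \<epsilon>" "\<epsilon> \<le> \<epsilon>'"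
  shows "C1_bound U K f \<epsilon>'"
proof -
  from assms(1) obtain D where "C1_bound_with U K f D \<epsilon>"
    unfolding C1_bound_def ..
  note f = C1_bound_withD[OF this]
  show ?thesis
    by (rule C1_boundI[OF f(1,2) order_trans[OF f(3) assms(2)]
          order_trans[OF f(4) mult_right_mono[OF assms(2) norm_ge_zero]]])
qed

lemma C1_bound_zero: "C1_bound U K (\<lambda>_. 0) 0"
  by (rule C1_boundI[where D="\<lambda>_ _. 0"]) auto

lemma C1_bound_add:
  assumes "C1_bound U K f \<epsilon>" "C1_bound U K g \<epsilon>'"
  shows "C1_bound U K (\<lambda>x. f x + g x) (\<epsilon> + \<epsilon>')"
proof -
  from assms(1) obtain D where "C1_bound_with U K f D \<epsilon>"
    unfolding C1_bound_def ..
  note f = C1_bound_withD[OF this]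
  from assms(2) obtain D' where "C1_bound_with U K g D' \<epsilon>'"
    unfolding C1_bound_def ..
  note g = C1_bound_withD[OF this]
  show ?thesis
  proof (rule C1_boundI[where D="\<lambda>x h. D x h + D' x h"])
    show "norm (D x h + D' x h) \<le> (\<epsilon> + \<epsilon>') * norm h" if "x \<in> K" for x h
      using norm_triangle_mono[OF f(4)[OF that] g(4)[OF that]] by (simp add: distrib_right)
  qed (auto intro!: has_derivative_add continuous_on_add norm_triangle_mono f g)
qed

lemma C1_bound_sum:
  assumes "finite I" "\<And>i. i \<in> I \<Longrightarrow> C1_bound U K (f i) (\<epsilon> i)"
  shows "C1_bound U K (\<lambda>x. \<Sum>i\<in>I. f i x) (\<Sum>i\<in>I. \<epsilon> i)"
  using assms by (induction I rule: finite_induct) (auto intro: C1_bound_zero C1_bound_add)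

lemma C1_bound_scaleR_left:
  fixes f :: "'a::euclidean_space \<Rightarrow> real"
  assumes "C1_bound U K f \<epsilon>"
  shows "C1_bound U K (\<lambda>x. f x *\<^sub>R c) (\<epsilon> * norm c)"
proof -
  from assms obtain D where "C1_bound_with U K f D \<epsilon>"
    unfolding C1_bound_def ..
  note f = C1_bound_withD[OF this]
  show ?thesis
  proof (rule C1_boundI[where D="\<lambda>x h. D x h *\<^sub>R c"])
    show "norm (D x h *\<^sub>R c) \<le> \<epsilon> * norm c * norm h" if "x \<in> K" for x h
      using mult_right_mono[OF f(4)[OF that, of h] norm_ge_zero[of c]] by (simp add: mult_ac)
    show "norm (f x *\<^sub>R c) \<le> \<epsilon> * norm c" if "x \<in> K" for x
      using mult_right_mono[OF f(3)[OF that] norm_ge_zero[of c]] by simp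
  qed (auto intro!: has_derivative_scaleR_left continuous_intros f)
qed

lemma C1_bound_cong:
  assumes "open U" "K \<subseteq> U" "\<And>x. x \<in> U \<Longrightarrow> f x = g x" "C1_bound U K f \<epsilon>"
  shows "C1_bound U K g \<epsilon>"
proof -
  from assms(4) obtain D where "C1_bound_with U K f D \<epsilon>"
    unfolding C1_bound_def ..
  note f = C1_bound_withD[OF this]
  show ?thesis
  proof (rule C1_boundI[where D=D])
    show "(g has_derivative D x) (at x)" if "x \<in> U" for x
      by (rule has_derivative_transform_within_open[OF f(1)[OF that] assms(1) that assms(3)])
    show "norm (g x) \<le> \<epsilon>" if "x \<in> K" for x
      using f(3)[OF that] assms(2,3) that by (metis subsetD)
  qed (fact f)+
qed

lemma C1_bound_matrix:
  fixes f :: "'a::euclidean_space \<Rightarrow> real ^ 'n ^ 'm"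
  assumes "\<And>i j. C1_bound U K (\<lambda>x. f x $ i $ j) (\<epsilon> i j)"
  shows "C1_bound U K f (\<Sum>i\<in>UNIV. \<Sum>j\<in>UNIV. \<epsilon> i j)"
proof -
  let ?E = "\<lambda>i j. axis i (axis j 1) :: real ^ 'n ^ 'm"
  have "norm (?E i j) = 1" for i j
    by (simp add: norm_eq_sqrt_inner inner_axis)
  then have "C1_bound U K (\<lambda>x. f x $ i $ j *\<^sub>R ?E i j) (\<epsilon> i j)" for i j
    using C1_bound_scaleR_left[OF assms[of i j], of "?E i j"] by simp
  then have "C1_bound U K (\<lambda>x. \<Sum>i\<in>UNIV. \<Sum>j\<in>UNIV. f x $ i $ j *\<^sub>R ?E i j)
      (\<Sum>i\<in>UNIV. \<Sum>j\<in>UNIV. \<epsilon> i j)"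
    by (intro C1_bound_sum) auto
  moreover have "(\<Sum>i\<in>UNIV. \<Sum>j\<in>UNIV. A $ i $ j *\<^sub>R ?E i j) = A" for A :: "real ^ 'n ^ 'm"
  proof -
    have "(\<Sum>i\<in>UNIV. \<Sum>j\<in>UNIV. A $ i $ j *\<^sub>R ?E i j) $ k $ l = A $ k $ l" for k l
    proof -
      have "(A $ i $ j *\<^sub>R ?E i j) $ k $ l = (if j = l then (if i = k then A $ i $ j else 0) else 0)" for i j
        by (auto simp: axis_def)
      then have "(\<Sum>i\<in>UNIV. \<Sum>j\<in>UNIV. A $ i $ j *\<^sub>R ?E i j) $ k $ l
          = (\<Sum>i\<in>UNIV. \<Sum>j\<in>UNIV. (if j = l then (if i = k then A $ i $ j else 0) else 0))"
        by (simp add: sum_component del: vector_scaleR_component)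
      then show ?thesis by simp
    qed
    then show ?thesis by (simp add: vec_eq_iff)
  qed
  ultimately show ?thesis by simp
qed

lemma C1_bound_imp_Ck_on_1:
  assumes "C1_bound U K f \<epsilon>"
  shows "Ck_on 1 f U"
proof -
  from assms obtain D where "C1_bound_with U K f D \<epsilon>"
    unfolding C1_bound_def ..
  note f = C1_bound_withD[OF this]
  show ?thesis by (rule Ck_on_1I[OF f(1,2)])
qed

lemma C1_norm_le:
  assumes "C1_bound U K f \<epsilon>" "K \<subseteq> U" "\<epsilon> \<ge> 0"
  shows "\<bar>C1_norm K f\<bar> \<le> 2 * \<epsilon>"
proof -
  from assms(1) obtain D where "C1_bound_with U K f D \<epsilon>"
    unfolding C1_bound_def ..
  note f = C1_bound_withD[OF this]
  have "onorm (frechet_derivative f (at x)) \<le> \<epsilon>" if "x \<in> K" for x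
    using f(4)[OF that] frechet_derivative_at[OF f(1)] that assms(2)
    by (intro onorm_le) (metis subsetD)
  then have up: "y \<le> \<epsilon>" if "y \<in> insert 0 ((\<lambda>x. norm (f x)) ` K)
      \<or> y \<in> insert 0 ((\<lambda>x. onorm (frechet_derivative f (at x))) ` K)" for y
    using that f(3) assms(3) by auto
  have sup: "0 \<le> Sup (insert 0 A) \<and> Sup (insert 0 A) \<le> \<epsilon>"
    if "\<And>y. y \<in> insert 0 A \<Longrightarrow> y \<le> \<epsilon>" for A
    using that by (intro conjI cSup_upper cSup_least) (auto intro!: bdd_aboveI)
  show ?thesis
    using sup[of "(\<lambda>x. norm (f x)) ` K"] sup[of "(\<lambda>x. onorm (frechet_derivative f (at x))) ` K"] up
    unfolding C1_norm_def by (smt (verit, best))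
qed

section \<open>The two parts of the error\<close>

context smoothing_kernel
begin

lemma average_translate_mem:
  assumes "\<And>z. z \<in> cbox a b \<Longrightarrow> norm z \<le> R" "0 < l" "l * R \<le> e" "z \<in> cbox a b"
  shows "x - l *\<^sub>R z \<in> cball x e"
proof -
  have "l * norm z \<le> l * R"
    using assms(1)[OF assms(4)] assms(2) by (intro mult_left_mono) auto
  then have "l * norm z \<le> e"
    using assms(3) by linarith
  then show ?thesis
    using assms(2) by (simp add: dist_norm)
qed

lemma translate_mem_neighbourhood:
  assumes "\<And>z. z \<in> cbox a b \<Longrightarrow> norm z \<le> R" "0 < l" "l * R \<le> e / 2"
    and "x \<in> (\<Union>x\<in>K. ball x (e / 2))" "z \<in> cbox a b"
  shows "x - l *\<^sub>R z \<in> (\<Union>x\<in>K. cball x e)"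
proof -
  from assms(4) obtain k where k: "k \<in> K" "dist k x < e / 2" by auto
  have "dist x (x - l *\<^sub>R z) \<le> e / 2"
    using average_translate_mem[OF assms(1-3,5)] by simp
  then show ?thesis
    using k dist_triangle[of k "x - l *\<^sub>R z" x] by force
qed

text \<open>The oscillation of each factor over \<open>x - l B\<close> is of order \<open>l powr \<alpha>\<close>. The commutator is
  quadratic in the oscillations, and one derivative of the kernel costs a factor \<open>1 / l\<close>.\<close>

lemma commutator_C1_bound:
  fixes F H :: "'a \<Rightarrow> 'b::euclidean_space"
  assumes K: "compact K" and R: "\<And>z. z \<in> cbox a b \<Longrightarrow> norm z \<le> R"
    and F: "continuous_on (\<Union>x\<in>K. cball x e) F" and H: "continuous_on (\<Union>x\<in>K. cball x e) H"
    and hF: "\<And>x y. x \<in> (\<Union>x\<in>K. cball x e) \<Longrightarrow> y \<in> (\<Union>x\<in>K. cball x e) \<Longrightarrow>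
      norm (F x - F y) \<le> c * dist x y powr \<alpha>"
    and hH: "\<And>x y. x \<in> (\<Union>x\<in>K. cball x e) \<Longrightarrow> y \<in> (\<Union>x\<in>K. cball x e) \<Longrightarrow>
      norm (H x - H y) \<le> c * dist x y powr \<alpha>"
    and pos: "0 < R" "0 < e" "0 < \<alpha>" "0 \<le> c"
  shows "\<exists>C\<ge>0. \<forall>l. 0 < l \<longrightarrow> l \<le> 1 \<longrightarrow> l * R \<le> e / 2 \<longrightarrow>
      C1_bound (\<Union>x\<in>K. ball x (e / 2)) K
        (\<lambda>x. mollify F l x \<bullet> mollify H l x - mollify (\<lambda>y. F y \<bullet> H y) l x) (C * l powr (2 * \<alpha> - 1))"
proof -
  let ?S = "\<Union>x\<in>K. cball x e" and ?U = "\<Union>x\<in>K. ball x (e / 2)"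
  let ?A = "\<lambda>h. average (cbox a b) (dkernel h)"
  define V where "V = measure lborel (cbox a b)"
  have closed: "closed ?S"
    using compact_imp_closed[OF compact_minkowski_sum_cball[OF K]] .
  have FH: "continuous_on ?S (\<lambda>y. F y \<bullet> H y)"
    by (intro continuous_intros F H)
  obtain N where N: "N \<ge> 0" "\<And>z. z \<in> cbox a b \<Longrightarrow> \<bar>\<phi> z\<bar> \<le> N"
    using kernel_bounded by metis
  obtain M where M: "M \<ge> 0" "\<And>z h. z \<in> cbox a b \<Longrightarrow> \<bar>dkernel h z\<bar> \<le> M * norm h"
    using C1_derivative_bounded_on_compact[OF C1 compact_cbox subset_UNIV, of a b] by auto
  define P where "P = (c * R powr \<alpha>)\<^sup>2"
  define C where "C = ((N * V)\<^sup>2 + N * V + (2 * N * V\<^sup>2 + V) * M) * P"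
  have V: "V \<ge> 0" by (simp add: V_def)
  have P: "P \<ge> 0" by (simp add: P_def)
  show ?thesis
  proof (intro exI[of _ C] conjI allI impI)
    show "C \<ge> 0"
      unfolding C_def using V N(1) M(1) P by simp
    fix l :: real
    assume l: "0 < l" "l \<le> 1" "l * R \<le> e / 2"
    have sub: "x - l *\<^sub>R z \<in> ?S" if "x \<in> ?U" "z \<in> cbox a b" for x z
      using translate_mem_neighbourhood[OF R l(1,3) that] .
    \<comment> \<open>A bound for the oscillation of either factor over \<open>x - l B\<close>.\<close>
    define E where "E = c * (l * R) powr \<alpha>"
    have E: "E \<ge> 0" using pos by (simp add: E_def)
    have E2: "E\<^sup>2 = P * l powr (2 * \<alpha>)"
      using l pos by (simp add: E_def P_def powr_mult power_mult_distrib powr_power mult_ac)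
    have lp: "l powr (2 * \<alpha>) \<le> l powr (2 * \<alpha> - 1)" "l powr (2 * \<alpha>) / l = l powr (2 * \<alpha> - 1)"
      using powr_mono'[of "2 * \<alpha> - 1" "2 * \<alpha>" l] l by (auto simp: powr_diff)
    have osc: "norm (G (x - l *\<^sub>R z) - G x) \<le> E"
      if G: "\<And>x y. x \<in> ?S \<Longrightarrow> y \<in> ?S \<Longrightarrow> norm (G x - G y) \<le> c * dist x y powr \<alpha>"
        and x: "x \<in> K" and z: "z \<in> cbox a b" for G :: "'a \<Rightarrow> 'b" and x z
    proof -
      have "x \<in> ?U" "x \<in> ?S" using x pos by force+
      then have "norm (G (x - l *\<^sub>R z) - G x) \<le> c * dist (x - l *\<^sub>R z) x powr \<alpha>"
        using G sub z by blast
      also have "\<dots> \<le> E"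
        unfolding E_def using mult_left_mono[OF R[OF z], of l] l pos
        by (intro mult_left_mono powr_mono2) (auto simp: dist_norm)
      finally show ?thesis .
    qed
    let ?D = "\<lambda>x h. (1 / l) * (mollify F l x \<bullet> ?A h H l x + ?A h F l x \<bullet> mollify H l x
        - ?A h (\<lambda>y. F y \<bullet> H y) l x)"
    show "C1_bound ?U K (\<lambda>x. mollify F l x \<bullet> mollify H l x - mollify (\<lambda>y. F y \<bullet> H y) l x)
        (C * l powr (2 * \<alpha> - 1))"
    proof (rule C1_boundI[where D="?D"])
      fix x assume x: "x \<in> ?U"
      have U: "open ?U" by auto
      have "((\<lambda>x. mollify F l x \<bullet> mollify H l x - mollify (\<lambda>y. F y \<bullet> H y) l x) has_derivative
          (\<lambda>h. mollify F l x \<bullet> ((1 / l) *\<^sub>R ?A h H l x) + ((1 / l) *\<^sub>R ?A h F l x) \<bullet> mollify H l x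
            - (1 / l) *\<^sub>R ?A h (\<lambda>y. F y \<bullet> H y) l x)) (at x)"
        by (intro has_derivative_diff has_derivative_inner
            mollify_has_derivative[OF F closed U x l(1) sub]
            mollify_has_derivative[OF H closed U x l(1) sub]
            mollify_has_derivative[OF FH closed U x l(1) sub])
      then show "((\<lambda>x. mollify F l x \<bullet> mollify H l x - mollify (\<lambda>y. F y \<bullet> H y) l x) has_derivative
          ?D x) (at x)"
        by (simp add: algebra_simps)
    next
      fix h
      show "continuous_on ?U (\<lambda>x. ?D x h)"
        by (intro continuous_intros average_continuous_on[OF kernel_continuous F sub]
            average_continuous_on[OF kernel_continuous H sub]
            average_continuous_on[OF dkernel_continuous F sub]
            average_continuous_on[OF dkernel_continuous H sub]
            average_continuous_on[OF dkernel_continuous FH sub])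
    next
      fix x assume x: "x \<in> K"
      then have xU: "x \<in> ?U" using pos by force
      have "\<bar>mollify F l x \<bullet> mollify H l x - mollify (\<lambda>y. F y \<bullet> H y) l x\<bar>
          \<le> ((N * V)\<^sup>2 + N * V) * E\<^sup>2"
        unfolding V_def
        by (rule commutator_norm_le[OF F H sub[OF xU] N(2,1) osc[OF hF x] osc[OF hH x] E])
      also have "\<dots> \<le> ((N * V)\<^sup>2 + N * V) * (P * l powr (2 * \<alpha> - 1))"
        unfolding E2 using lp(1) V N(1) P by (intro mult_left_mono) auto
      also have "\<dots> \<le> C * l powr (2 * \<alpha> - 1)"
        unfolding C_def using V N(1) M(1) P by (simp add: algebra_simps)
      finally show "norm (mollify F l x \<bullet> mollify H l x - mollify (\<lambda>y. F y \<bullet> H y) l x)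
          \<le> C * l powr (2 * \<alpha> - 1)"
        by simp
      fix h
      have "\<bar>mollify F l x \<bullet> ?A h H l x + ?A h F l x \<bullet> mollify H l x - ?A h (\<lambda>y. F y \<bullet> H y) l x\<bar>
          \<le> (2 * N * V\<^sup>2 + V) * (M * norm h) * E\<^sup>2"
        unfolding V_def
        by (rule commutator_derivative_norm_le[OF F H sub[OF xU] N(2,1) M(2)
              mult_nonneg_nonneg[OF M(1) norm_ge_zero] osc[OF hF x] osc[OF hH x] E])
      then have "norm (?D x h) \<le> (2 * N * V\<^sup>2 + V) * (M * norm h) * E\<^sup>2 / l"
        using l(1) by (simp add: abs_mult divide_right_mono)
      also have "\<dots> = (2 * N * V\<^sup>2 + V) * M * P * l powr (2 * \<alpha> - 1) * norm h"
        unfolding E2 lp(2)[symmetric] by simp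
      also have "\<dots> \<le> C * l powr (2 * \<alpha> - 1) * norm h"
        unfolding C_def using V N(1) M(1) P
        by (intro mult_right_mono) (auto simp: algebra_simps)
      finally show "norm (?D x h) \<le> C * l powr (2 * \<alpha> - 1) * norm h" .
    qed
  qed
qed

text \<open>Both \<open>G\<close> and its derivative are Lipschitz near \<open>K\<close>, so that averaging over \<open>x - l B\<close> changes
  them by at most a multiple of \<open>l\<close>.\<close>

lemma mollification_error_C1_bound:
  fixes G :: "'a \<Rightarrow> 'b::euclidean_space"
  assumes K: "compact K" and R: "\<And>z. z \<in> cbox a b \<Longrightarrow> norm z \<le> R"
    and G: "Ck_on 2 G S" and S: "(\<Union>x\<in>K. cball x e) \<subseteq> S" and pos: "0 < R" "0 < e"
  shows "\<exists>C\<ge>0. \<forall>l. 0 < l \<longrightarrow> l * R \<le> e / 2 \<longrightarrow>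
      C1_bound (\<Union>x\<in>K. ball x (e / 2)) K (\<lambda>x. mollify G l x - G x) (C * l)"
proof -
  let ?U = "\<Union>x\<in>K. ball x (e / 2)" and ?d = "\<lambda>h x. frechet_derivative G (at x) h"
  have "Ck_on (Suc 1) G S"
    using G by (simp add: numeral_2_eq_2)
  then have dG: "G differentiable (at x)" "Ck_on 1 (?d h) S" if "x \<in> S" for x h
    using that by auto
  have dG': "Ck_on 1 (?d h) S" for h
    using \<open>Ck_on (Suc 1) G S\<close> by simp
  have G1: "Ck_on 1 G S"
    using dG(1) Ck_on_1D(3)[OF dG'] by simp
  have lin: "linear (\<lambda>h. ?d h x)" if "x \<in> S" for x
    using has_derivative_linear[OF Ck_on_1D(1)[OF G1 that]] .
  obtain N where N: "N \<ge> 0" "\<And>z. z \<in> cbox a b \<Longrightarrow> \<bar>\<phi> z\<bar> \<le> N"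
    using kernel_bounded by metis
  obtain C0 where C0: "C0 \<ge> 0"
    "\<And>x y. x \<in> K \<Longrightarrow> y \<in> cball x e \<Longrightarrow> norm (G y - G x) \<le> C0 * norm (y - x)"
    using C1_lipschitz_near_compact[OF G1 K S] by metis
  have "\<exists>C\<ge>0. \<forall>x\<in>K. \<forall>y\<in>cball x e. norm (?d k y - ?d k x) \<le> C * norm (y - x)" for k
    using C1_lipschitz_near_compact[OF dG' K S, of k] by metis
  then obtain L where L: "\<And>k. L k \<ge> 0"
    "\<And>k x y. x \<in> K \<Longrightarrow> y \<in> cball x e \<Longrightarrow> norm (?d k y - ?d k x) \<le> L k * norm (y - x)"
    by metis
  define L1 where "L1 = (\<Sum>k\<in>Basis. L k)"
  have L1: "L1 \<ge> 0" using L(1) by (simp add: L1_def sum_nonneg)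
  have lip: "norm (?d h y - ?d h x) \<le> L1 * norm h * norm (y - x)"
    if "x \<in> K" "y \<in> cball x e" for h x y
  proof -
    have "x \<in> S" "y \<in> S" using that S pos by force+
    then have "linear (\<lambda>h. ?d h y - ?d h x)"
      using lin by (intro linear_compose_sub) auto
    from linear_norm_le_sum_Basis[OF this, of h]
    have "norm (?d h y - ?d h x) \<le> (\<Sum>k\<in>Basis. norm (?d k y - ?d k x)) * norm h" .
    also have "\<dots> \<le> (\<Sum>k\<in>Basis. L k * norm (y - x)) * norm h"
      using L(2)[OF that] by (intro mult_right_mono sum_mono) auto
    finally show ?thesis
      by (simp add: L1_def sum_distrib_right mult_ac)
  qed
  define V where "V = measure lborel (cbox a b)"
  define C where "C = N * (C0 + L1) * R * V"
  have V: "V \<ge> 0" by (simp add: V_def)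
  show ?thesis
  proof (intro exI[of _ C] conjI allI impI)
    show "C \<ge> 0" unfolding C_def using N(1) C0(1) L1 pos V by simp
    fix l :: real assume l: "0 < l" "l * R \<le> e / 2"
    have sub: "x - l *\<^sub>R z \<in> S" if "x \<in> ?U" "z \<in> cbox a b" for x z
      using translate_mem_neighbourhood[OF R l that] S by blast
    have est: "norm (mollify g l x - g x) \<le> N * (c * (l * R)) * V"
      if g: "continuous_on S g" and x: "x \<in> K" and c: "c \<ge> 0"
        and lg: "\<And>y. y \<in> cball x e \<Longrightarrow> norm (g y - g x) \<le> c * norm (y - x)"
      for g :: "'a \<Rightarrow> 'b" and x c
    proof -
      have xU: "x \<in> ?U" using x pos by force
      have "norm (g (x - l *\<^sub>R z) - g x) \<le> c * (l * R)" if z: "z \<in> cbox a b" for z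
      proof -
        have *: "x - l *\<^sub>R z \<in> cball x (l * R)"
          by (rule average_translate_mem[OF R l(1) order_refl z])
        have "norm (g (x - l *\<^sub>R z) - g x) \<le> c * norm (x - l *\<^sub>R z - x)"
        proof (rule lg)
          have "l * R \<le> e" using l pos by linarith
          from subset_cball[OF this] * show "x - l *\<^sub>R z \<in> cball x e" by blast
        qed
        also have "\<dots> \<le> c * (l * R)"
          using * c by (intro mult_left_mono) (auto simp: dist_norm)
        finally show ?thesis .
      qed
      from average_diff_const_norm_le[where a=a and b=b, OF kernel_continuous g sub[OF xU] N(2) this N(1)]
      show ?thesis
        using c l pos by (simp add: mean_one V_def)
    qed
    show "C1_bound ?U K (\<lambda>x. mollify G l x - G x) (C * l)"
    proof (rule C1_boundI[where D="\<lambda>x h. mollify (?d h) l x - ?d h x"])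
      fix x assume x: "x \<in> ?U"
      then have "x \<in> S" using S pos by force
      have U: "open ?U" by auto
      show "((\<lambda>x. mollify G l x - G x) has_derivative (\<lambda>h. mollify (?d h) l x - ?d h x)) (at x)"
        by (intro has_derivative_diff average_has_derivative_C1[OF kernel_continuous G1 U x sub]
            Ck_on_1D(1)[OF G1 \<open>x \<in> S\<close>])
    next
      fix h
      have "?U \<subseteq> S" using S pos by force
      then show "continuous_on ?U (\<lambda>x. mollify (?d h) l x - ?d h x)"
        by (intro continuous_intros average_continuous_on[OF kernel_continuous Ck_on_1D(2)[OF G1] sub]
            continuous_on_subset[OF Ck_on_1D(2)[OF G1]])
    next
      fix x assume x: "x \<in> K"
      have "norm (mollify G l x - G x) \<le> N * (C0 * (l * R)) * V"
        by (rule est[OF Ck_on_1D(3)[OF G1] x C0(1) C0(2)[OF x]])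
      also have "\<dots> \<le> C * l"
        unfolding C_def using N(1) L1 pos V l by (simp add: algebra_simps)
      finally show "norm (mollify G l x - G x) \<le> C * l" .
      fix h
      have "norm (mollify (?d h) l x - ?d h x) \<le> N * (L1 * norm h * (l * R)) * V"
        by (rule est[OF Ck_on_1D(2)[OF G1] x _ lip[OF x]]) (use L1 in simp)
      also have "\<dots> = (N * L1 * R * V * l) * norm h" by simp
      also have "\<dots> \<le> (C * l) * norm h"
        unfolding C_def using N(1) C0(1) pos V l
        by (intro mult_right_mono) (auto simp: algebra_simps)
      finally show "norm (mollify (?d h) l x - ?d h x) \<le> C * l * norm h" .
    qed
  qed
qed

end

section \<open>Convolution with the rescaled kernel\<close>

lemma support_rescaled_kernel:
  fixes \<phi> :: "real ^ 'n \<Rightarrow> real"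
  assumes "\<And>z. z \<notin> cbox a b \<Longrightarrow> \<phi> z = 0" "l > 0" "y \<in> tsupport (rescaled_kernel \<phi> l)"
  shows "\<exists>z\<in>cbox a b. y = l *\<^sub>R z"
proof -
  have "tsupport (rescaled_kernel \<phi> l) \<subseteq> (*\<^sub>R) l ` cbox a b"
  proof (rule closure_minimal)
    show "closed ((*\<^sub>R) l ` cbox a b)"
      by (intro closed_scaling closed_cbox)
    show "support_on UNIV (rescaled_kernel \<phi> l) \<subseteq> (*\<^sub>R) l ` cbox a b"
    proof
      fix y assume "y \<in> support_on UNIV (rescaled_kernel \<phi> l)"
      then have "y /\<^sub>R l \<in> cbox a b"
        using assms(1)[of "y /\<^sub>R l"] by (auto simp: support_on_def rescaled_kernel_def)
      then show "y \<in> (*\<^sub>R) l ` cbox a b"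
        using assms(2) by (intro image_eqI[of _ _ "y /\<^sub>R l"]) auto
    qed
  qed
  then show ?thesis using assms(3) by auto
qed

lemma convolve_rescaled_kernel_eq_average:
  fixes v :: "real ^ 'n \<Rightarrow> real ^ 'm" and \<phi> :: "real ^ 'n \<Rightarrow> real"
  assumes \<phi>: "continuous_on UNIV \<phi>" "\<And>z. z \<notin> cbox a b \<Longrightarrow> \<phi> z = 0"
    and v: "continuous_on S v" "\<And>z. z \<in> cbox a b \<Longrightarrow> x - l *\<^sub>R z \<in> S" and l: "l > 0"
  shows "convolve v (rescaled_kernel \<phi> l) x = average (cbox a b) \<phi> v l x"
proof -
  let ?k = "\<lambda>y. rescaled_kernel \<phi> l y *\<^sub>R v (x - y)"
  have mem: "y /\<^sub>R l \<in> cbox a b \<longleftrightarrow> y \<in> cbox (l *\<^sub>R a) (l *\<^sub>R b)" for y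
    using l by (simp add: mem_box_cart field_simps)
  have cont: "continuous_on (cbox (l *\<^sub>R a) (l *\<^sub>R b)) ?k"
    unfolding rescaled_kernel_def
  proof (intro continuous_intros continuous_on_compose2[OF \<phi>(1)] continuous_on_compose2[OF v(1)])
    show "(-) x ` cbox (l *\<^sub>R a) (l *\<^sub>R b) \<subseteq> S"
    proof clarify
      fix y assume "y \<in> cbox (l *\<^sub>R a) (l *\<^sub>R b)"
      then show "x - y \<in> S"
        using v(2)[of "y /\<^sub>R l"] mem[of y] l by simp
    qed
  qed (use l in auto)
  then have "(?k has_integral integral (cbox (l *\<^sub>R a) (l *\<^sub>R b)) ?k) (cbox (l *\<^sub>R a) (l *\<^sub>R b))"
    by (intro integrable_integral integrable_continuous)
  moreover have "integral (cbox (l *\<^sub>R a) (l *\<^sub>R b)) ?k = convolve v (rescaled_kernel \<phi> l) x"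
    unfolding convolve_def
    by (rule lborel_integral_eq_integral_cbox[OF cont, symmetric])
       (use \<phi>(2) mem in \<open>auto simp: rescaled_kernel_def\<close>)
  ultimately have "((\<lambda>z. ?k (l *\<^sub>R z)) has_integral convolve v (rescaled_kernel \<phi> l) x /\<^sub>R l ^ CARD('n))
      (cbox a b)"
    using has_integral_affinity'[of ?k _ "l *\<^sub>R a" "l *\<^sub>R b" l 0] l by simp
  from has_integral_cmul[OF this, of "l ^ CARD('n)"]
  have "((\<lambda>z. \<phi> z *\<^sub>R v (x - l *\<^sub>R z)) has_integral convolve v (rescaled_kernel \<phi> l) x) (cbox a b)"
    using l by (simp add: rescaled_kernel_def)
  then show ?thesis
    unfolding average_def by (simp add: integral_unique)
qed

lemma smoothing_kernel_of_standard_symmetric_kernel: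
  fixes \<phi> :: "real ^ 'n \<Rightarrow> real"
  assumes "standard_symmetric_kernel \<phi>"
  obtains c where "smoothing_kernel \<phi> (- c) c"
proof -
  have C1: "Ck_on 1 \<phi> UNIV" and "compact (tsupport \<phi>)" and int: "(LINT x|lborel. \<phi> x) = 1"
    using assms unfolding standard_symmetric_kernel_def by blast+
  obtain c where c: "tsupport \<phi> \<subseteq> cbox (- c) c"
    using bounded_subset_cbox_symmetric[OF compact_imp_bounded[OF \<open>compact (tsupport \<phi>)\<close>]] by metis
  have vanish: "\<phi> z = 0" if "z \<notin> cbox (- c) c" for z
    using that c closure_subset[of "support_on UNIV \<phi>"] by (auto simp: support_on_def)
  have "integral (cbox (- c) c) \<phi> = 1"
    using lborel_integral_eq_integral_cbox[OF continuous_on_subset[OF Ck_on_1D(3)[OF C1] subset_UNIV] vanish]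
      int by simp
  with C1 vanish have "smoothing_kernel \<phi> (- c) c"
    by unfold_locales auto
  then show ?thesis by (rule that)
qed

section \<open>The pullback metric of a mollified map\<close>

theorem proposition1p6:
  fixes \<Omega> K :: "(real ^ 'n) set"
    and v :: "real ^ 'n \<Rightarrow> real ^ 'm"
    and \<phi> :: "real ^ 'n \<Rightarrow> real"
    and \<alpha> :: real
  assumes "open \<Omega>"
    and "0 < \<alpha>" and "\<alpha> \<le> 1"
    and "C1_holder_on \<alpha> v \<Omega>"
    and "Ck_on 2 (pullback_metric v) \<Omega>"
    and "standard_symmetric_kernel \<phi>"
    and "compact K" and "K \<subseteq> \<Omega>"
  shows "(\<forall>\<^sub>F l in at_right 0. \<exists>U. open U \<and> K \<subseteq> U \<and> U \<subseteq> \<Omega> \<and>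
            convolution_defined_on \<Omega> (rescaled_kernel \<phi> l) U \<and>
            Ck_on 1 (\<lambda>x. pullback_metric (convolve v (rescaled_kernel \<phi> l)) x - pullback_metric v x) U)
       \<and> (\<lambda>l. C1_norm K
              (\<lambda>x. pullback_metric (convolve v (rescaled_kernel \<phi> l)) x - pullback_metric v x))
           \<in> O[at_right 0](\<lambda>l. l powr (2 * \<alpha> - 1))"
proof -
  obtain c where "smoothing_kernel \<phi> (- c) c"
    using smoothing_kernel_of_standard_symmetric_kernel[OF assms(6)] .
  then interpret smoothing_kernel \<phi> "- c" c .
  obtain e where e: "e > 0" "(\<Union>x\<in>K. cball x e) \<subseteq> \<Omega>"
    using compact_subset_open_imp_cball_epsilon_subset[OF assms(7,1,8)] by metis
  obtain R0 where "\<And>z. z \<in> cbox (- c) c \<Longrightarrow> norm z \<le> R0"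
    using bounded_cbox[of "- c" c] by (auto simp: bounded_iff)
  then obtain R where R: "R > 0" "\<And>z. z \<in> cbox (- c) c \<Longrightarrow> norm z \<le> R"
    by (metis less_max_iff_disj max.coboundedI1 zero_less_one)
  define U where "U = (\<Union>x\<in>K. ball x (e / 2))"
  have U: "open U" "K \<subseteq> U" "U \<subseteq> \<Omega>"
    using e by (force simp: U_def)+
  let ?S = "\<Union>x\<in>K. cball x e"
  let ?F = "\<lambda>i x. frechet_derivative v (at x) (axis i 1)"
  have C1v: "Ck_on 1 v \<Omega>"
    using assms(4) by (simp add: C1_holder_on_def)
  \<comment> \<open>The constant \<open>H0\<close> can be negative when \<open>K\<close> is empty.\<close>
  obtain H0 where H0: "\<And>x y. x \<in> ?S \<Longrightarrow> y \<in> ?S \<Longrightarrow>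
      onorm (\<lambda>h. frechet_derivative v (at x) h - frechet_derivative v (at y) h) \<le> H0 * dist x y powr \<alpha>"
    using assms(4) compact_minkowski_sum_cball[OF assms(7), of e] e(2) unfolding C1_holder_on_def by meson
  have holder: "norm (?F i x - ?F i y) \<le> \<bar>H0\<bar> * dist x y powr \<alpha>" if xy: "x \<in> ?S" "y \<in> ?S" for i x y
  proof -
    have "bounded_linear (frechet_derivative v (at z))" if "z \<in> ?S" for z
      using Ck_on_1D(1)[OF C1v, of z] e(2) that by (blast intro: has_derivative_bounded_linear)
    then have "bounded_linear (\<lambda>h. frechet_derivative v (at x) h - frechet_derivative v (at y) h)"
      using xy by (intro bounded_linear_sub)
    from onorm[OF this, of "axis i 1"]
    have "norm (?F i x - ?F i y)
        \<le> onorm (\<lambda>h. frechet_derivative v (at x) h - frechet_derivative v (at y) h)"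
      by simp
    also have "\<dots> \<le> \<bar>H0\<bar> * dist x y powr \<alpha>"
      by (rule order_trans[OF H0[OF xy]]) (simp add: mult_right_mono)
    finally show ?thesis .
  qed
  have Fcont: "continuous_on ?S (?F i)" for i
    using continuous_on_subset[OF Ck_on_1D(2)[OF C1v] e(2)] .
  have G: "pullback_metric v x $ i $ j = ?F i x \<bullet> ?F j x" for x i j
    by (simp add: pullback_metric_def)
  have "bounded_linear (\<lambda>A :: real ^ 'n ^ 'n. A $ i $ j)" for i j
    by (intro bounded_linear_vec_nth bounded_linear_compose[OF bounded_linear_vec_nth])
  then have G2: "Ck_on 2 (\<lambda>x. ?F i x \<bullet> ?F j x) \<Omega>" for i j
    using Ck_on_bounded_linear[OF _ assms(1,5), of "\<lambda>A. A $ i $ j"] by (simp add: G)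
  \<comment> \<open>Below \<open>l0\<close> the kernel moves points of \<open>U\<close> by at most \<open>e / 2\<close>, hence inside the \<open>e\<close>-neighbourhood
    of \<open>K\<close>, and \<open>l\<close> is bounded by \<open>l powr (2 * \<alpha> - 1)\<close>.\<close>
  define l0 where "l0 = min 1 (e / (2 * R))"
  have l0: "l0 > 0" using e R by (simp add: l0_def)
  have small: "l \<le> 1" "l * R \<le> e / 2" if "l < l0" for l
    using that R(1) by (auto simp: l0_def field_simps)
  define P where "P i j C \<longleftrightarrow> C \<ge> 0 \<and> (\<forall>l. 0 < l \<longrightarrow> l < l0 \<longrightarrow> C1_bound U K
      (\<lambda>x. mollify (?F i) l x \<bullet> mollify (?F j) l x - ?F i x \<bullet> ?F j x) (C * l powr (2 * \<alpha> - 1)))"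
    for i j C
  have "\<exists>C. P i j C" for i j
  proof -
    obtain A where A: "A \<ge> 0 \<and> (\<forall>l. 0 < l \<longrightarrow> l \<le> 1 \<longrightarrow> l * R \<le> e / 2 \<longrightarrow> C1_bound U K
        (\<lambda>x. mollify (?F i) l x \<bullet> mollify (?F j) l x - mollify (\<lambda>y. ?F i y \<bullet> ?F j y) l x)
        (A * l powr (2 * \<alpha> - 1)))"
      using commutator_C1_bound[OF assms(7) R(2) Fcont[of i] Fcont[of j] holder holder
          R(1) e(1) assms(2) abs_ge_zero, folded U_def] ..
    obtain B where B: "B \<ge> 0 \<and> (\<forall>l. 0 < l \<longrightarrow> l * R \<le> e / 2 \<longrightarrow> C1_bound U K
        (\<lambda>x. mollify (\<lambda>y. ?F i y \<bullet> ?F j y) l x - ?F i x \<bullet> ?F j x) (B * l))"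
      using mollification_error_C1_bound[OF assms(7) R(2) G2[of i j] e(2) R(1) e(1), folded U_def] ..
    have "C1_bound U K (\<lambda>x. mollify (?F i) l x \<bullet> mollify (?F j) l x - ?F i x \<bullet> ?F j x)
        ((A + B) * l powr (2 * \<alpha> - 1))" if "0 < l" "l < l0" for l
    proof (rule C1_bound_mono)
      show "C1_bound U K (\<lambda>x. mollify (?F i) l x \<bullet> mollify (?F j) l x - ?F i x \<bullet> ?F j x)
          (A * l powr (2 * \<alpha> - 1) + B * l)"
        using C1_bound_add[OF A[THEN conjunct2, rule_format, OF that(1) small[OF that(2)]]
            B[THEN conjunct2, rule_format, OF that(1) small(2)[OF that(2)]]] by simp
      have "l powr 1 \<le> l powr (2 * \<alpha> - 1)"
        using that small[OF that(2)] assms(3) by (intro powr_mono') auto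
      then show "A * l powr (2 * \<alpha> - 1) + B * l \<le> (A + B) * l powr (2 * \<alpha> - 1)"
        using that B by (simp add: distrib_right mult_left_mono)
    qed
    then show ?thesis
      unfolding P_def using A B by (intro exI[of _ "A + B"]) auto
  qed
  then obtain C where "\<And>i j. P i j (C i j)"
    by metis
  then have C: "\<And>i j l. 0 < l \<Longrightarrow> l < l0 \<Longrightarrow> C1_bound U K
      (\<lambda>x. mollify (?F i) l x \<bullet> mollify (?F j) l x - ?F i x \<bullet> ?F j x) (C i j * l powr (2 * \<alpha> - 1))"
    "\<And>i j. C i j \<ge> 0"
    unfolding P_def by blast+
  let ?w = "\<lambda>l. convolve v (rescaled_kernel \<phi> l)"
  let ?err = "\<lambda>l x. pullback_metric (?w l) x - pullback_metric v x"
  define T where "T = (\<Sum>i\<in>UNIV. \<Sum>j\<in>UNIV. C i j)"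
  have T: "T \<ge> 0" using C(2) by (simp add: T_def sum_nonneg)
  have sub: "x - l *\<^sub>R z \<in> \<Omega>" if "0 < l" "l < l0" "x \<in> U" "z \<in> cbox (- c) c" for l x z
    using translate_mem_neighbourhood[OF R(2) that(1) small(2)[OF that(2)] that(3)[unfolded U_def] that(4)]
      e(2) by blast
  have err: "C1_bound U K (?err l) (T * l powr (2 * \<alpha> - 1))" if l: "0 < l" "l < l0" for l
  proof -
    have w: "?w l x = mollify v l x" if "x \<in> U" for x
      by (rule convolve_rescaled_kernel_eq_average[OF kernel_continuous vanishes Ck_on_1D(3)[OF C1v]
            sub[OF l that] l(1)])
    have dw: "frechet_derivative (?w l) (at x) h = mollify (\<lambda>y. frechet_derivative v (at y) h) l x"
      if x: "x \<in> U" for x h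
    proof -
      have "(?w l has_derivative (\<lambda>h. mollify (\<lambda>y. frechet_derivative v (at y) h) l x)) (at x)"
        by (rule has_derivative_transform_within_open[OF
              average_has_derivative_C1[OF kernel_continuous C1v U(1) x sub[OF l]] U(1) x w[symmetric]])
      from frechet_derivative_at[OF this] show ?thesis by metis
    qed
    have "C1_bound U K (\<lambda>x. ?err l x $ i $ j) (C i j * l powr (2 * \<alpha> - 1))" for i j
      by (rule C1_bound_cong[OF U(1,2) _ C(1)[OF l]]) (simp add: pullback_metric_def dw)
    from C1_bound_matrix[OF this] show ?thesis
      by (simp add: T_def sum_distrib_right)
  qed
  have ev: "\<forall>\<^sub>F l in at_right 0. 0 < l \<and> l < l0"
    using eventually_at_right_real[OF l0] by (simp add: greaterThanLessThan_iff)
  show ?thesis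
  proof
    show "\<forall>\<^sub>F l in at_right 0. \<exists>U. open U \<and> K \<subseteq> U \<and> U \<subseteq> \<Omega> \<and>
        convolution_defined_on \<Omega> (rescaled_kernel \<phi> l) U \<and> Ck_on 1 (?err l) U"
    proof (rule eventually_mono[OF ev], intro exI[of _ U] conjI U)
      fix l assume l: "0 < l \<and> l < l0"
      show "convolution_defined_on \<Omega> (rescaled_kernel \<phi> l) U"
        unfolding convolution_defined_on_def
      proof (intro ballI)
        fix x y assume x: "x \<in> U" and y: "y \<in> tsupport (rescaled_kernel \<phi> l)"
        obtain z where "z \<in> cbox (- c) c" "y = l *\<^sub>R z"
          using support_rescaled_kernel[OF vanishes _ y] l by blast
        then show "x - y \<in> \<Omega>"
          using sub[of l x z] l x by simp
      qed
      show "Ck_on 1 (?err l) U"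
        using C1_bound_imp_Ck_on_1[OF err] l by blast
    qed
    show "(\<lambda>l. C1_norm K (?err l)) \<in> O[at_right 0](\<lambda>l. l powr (2 * \<alpha> - 1))"
    proof (rule bigoI)
      show "\<forall>\<^sub>F l in at_right 0. norm (C1_norm K (?err l)) \<le> (2 * T) * norm (l powr (2 * \<alpha> - 1))"
        using ev
      proof eventually_elim
        fix l assume l: "0 < l \<and> l < l0"
        from C1_norm_le[OF err U(2)] l T
        show "norm (C1_norm K (?err l)) \<le> (2 * T) * norm (l powr (2 * \<alpha> - 1))"
          by (simp add: mult.assoc)
      qed
    qed
  qed
qed

end
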